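(* Let $1\le p\le\infty$ and let $A, B \in \mathbb{C}^{n\times n}$ be non-zero Hermitian positive semi-definite matrices. Then $$\sqrt[p]{\operatorname{sr}_p(A+B)} \le \sqrt[p]{\operatorname{sr}_p(A)} + \sqrt[p]{\operatorname{sr}_p(B)}.$$
   Context: For $A\in\mathbb{C}^{m\times n}$ with singular values $\sigma_1(A)\ge\cdots\ge\sigma_{\min\{m,n\}}(A)\ge 0$, the Schatten $p$-norm is $\|A\|_{(p)} = \left(\sum_{j}\sigma_j(A)^p\right)^{1/p}$ for $1\le p<\infty$, and $\|A\|_{(\infty)}=\sigma_1(A)=\|A\|_2$ is the operator two-norm. For $1\le p\le\infty$ the $p$-stable rank of a non-zero matrix $A$ is $\operatorname{sr}_p(A) = \|A\|_{(p)}^p/\|A\|_2^p$, with $\operatorname{sr}_\infty(A)=1$; for the zero matrix, $\operatorname{sr}_p(0)=0$. For non-zero $A$, $\sqrt[p]{\operatorname{sr}_p(A)}=\|A\|_{(p)}/\|A\|_2$; for $p=\infty$ the $p$-th root is understood in this sense, so it equals $1$. *)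

theory Defs
  imports
    "Jordan_Normal_Form.Schur_Decomposition"
    "HOL-Library.Extended_Real"
begin

definition hermitian_mat :: "complex mat \<Rightarrow> bool" where
  "hermitian_mat A \<longleftrightarrow> square_mat A \<and> mat_adjoint A = A"

(* For Hermitian A the number v^* A v is real, so Re discards nothing. *)
definition hermitian_psd :: "complex mat \<Rightarrow> bool" where
  "hermitian_psd A \<longleftrightarrow>
     hermitian_mat A \<and> (\<forall>v \<in> carrier_vec (dim_col A). 0 \<le> Re ((A *\<^sub>v v) \<bullet>c v))"

(* The singular values of an m x n matrix A in decreasing order: square roots of the min m n
   largest eigenvalues of A^* A, counted with algebraic multiplicity. These eigenvalues are real
   and nonnegative, and for m < n at least n - m of them vanish; take drops n - m zeros. *)
definition singular_values :: "complex mat \<Rightarrow> real list" where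
  "singular_values A =
     take (min (dim_row A) (dim_col A))
       (rev (sorted_list_of_multiset
         (image_mset (\<lambda>z. sqrt (Re z)) (proots (char_poly (mat_adjoint A * A))))))"

(* For p = \<infinity> this is the largest singular value; it is unspecified for matrices without
   rows or columns. *)
definition schatten_norm :: "ereal \<Rightarrow> complex mat \<Rightarrow> real" where
  "schatten_norm p A =
     (if p = \<infinity> then hd (singular_values A)
      else (\<Sum>\<sigma>\<leftarrow>singular_values A. \<sigma> powr real_of_ereal p) powr (1 / real_of_ereal p))"

definition vec_norm2 :: "complex vec \<Rightarrow> real" where
  "vec_norm2 v = sqrt (\<Sum>i<dim_vec v. (cmod (v $ i))\<^sup>2)"

definition op_norm2 :: "complex mat \<Rightarrow> real" where
  "op_norm2 A = (SUP v \<in> {v \<in> carrier_vec (dim_col A). vec_norm2 v \<le> 1}. vec_norm2 (A *\<^sub>v v))"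

definition stable_rank :: "ereal \<Rightarrow> complex mat \<Rightarrow> real" where
  "stable_rank p A =
     (if A = 0\<^sub>m (dim_row A) (dim_col A) then 0
      else if p = \<infinity> then 1
      else schatten_norm p A powr real_of_ereal p / op_norm2 A powr real_of_ereal p)"

(* The p-th root of stable_rank p A. For p = \<infinity> it is read as the quotient of the norms, which
   is what the root equals for finite p and non-zero A. *)
definition stable_rank_root :: "ereal \<Rightarrow> complex mat \<Rightarrow> real" where
  "stable_rank_root p A =
     (if p = \<infinity> then schatten_norm \<infinity> A / op_norm2 A
      else stable_rank p A powr (1 / real_of_ereal p))"

end

theory Submission
  imports Defs "HOL-Computational_Algebra.Fundamental_Theorem_Algebra" "HOL-Analysis.Convex"
begin

text \<open>Since \<open>A\<close> and \<open>B\<close> are positive semi-definite, the operator norm of \<open>A + B\<close> is at least that of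
  \<open>A\<close> and that of \<open>B\<close>, so the claim reduces to the triangle inequality for the Schatten norm.
  For an orthonormal eigenbasis \<open>u\<^sub>i\<close> of \<open>A + B\<close> the eigenvalues are the sums of the diagonal entries
  \<open>\<langle>A u\<^sub>i, u\<^sub>i\<rangle>\<close> and \<open>\<langle>B u\<^sub>i, u\<^sub>i\<rangle>\<close>. Minkowski's inequality separates the two families, and by convexity
  the \<open>\<ell>\<^sup>p\<close> norm of the diagonal of \<open>A\<close> in any orthonormal basis is at most that of its eigenvalues.\<close>

section \<open>Algebra of the adjoint\<close>

lemma mat_adjoint_dim [simp]:
  "dim_row (mat_adjoint A) = dim_col A" "dim_col (mat_adjoint A) = dim_row A"
  by (auto simp: mat_adjoint_def)

lemma mat_adjoint_carrier [intro, simp]: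
  "A \<in> carrier_mat m n \<Longrightarrow> mat_adjoint A \<in> carrier_mat n m"
  by (auto intro!: carrier_matI)

lemma mat_adjoint_index [simp]:
  "i < dim_col A \<Longrightarrow> j < dim_row A \<Longrightarrow> mat_adjoint A $$ (i, j) = conjugate (A $$ (j, i))"
  by (auto simp: mat_adjoint_def mat_of_rows_index)

lemma mat_adjoint_adjoint [simp]: "mat_adjoint (mat_adjoint A) = A"
  by (rule eq_matI) auto

lemma mat_adjoint_one [simp]: "mat_adjoint (1\<^sub>m n :: complex mat) = 1\<^sub>m n"
  by (rule eq_matI) auto

lemma mat_adjoint_mult:
  fixes A B :: "complex mat"
  assumes "A \<in> carrier_mat m n" "B \<in> carrier_mat n k"
  shows "mat_adjoint (A * B) = mat_adjoint B * mat_adjoint A"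
  using assms by (intro eq_matI) (auto simp: scalar_prod_def mult.commute)

lemma mat_adjoint_add:
  fixes A B :: "complex mat"
  assumes "A \<in> carrier_mat m n" "B \<in> carrier_mat m n"
  shows "mat_adjoint (A + B) = mat_adjoint A + mat_adjoint B"
  using assms by (intro eq_matI) auto

lemma mat_adjoint_four_block:
  fixes A B C D :: "complex mat"
  assumes "A \<in> carrier_mat m n" "B \<in> carrier_mat m k" "C \<in> carrier_mat l n" "D \<in> carrier_mat l k"
  shows "mat_adjoint (four_block_mat A B C D) =
    four_block_mat (mat_adjoint A) (mat_adjoint C) (mat_adjoint B) (mat_adjoint D)"
  using assms by (intro eq_matI) auto

lemma adjoint_mult_index:
  fixes U V :: "complex mat"
  assumes "U \<in> carrier_mat m n" "V \<in> carrier_mat m k" "i < n" "j < k"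
  shows "(mat_adjoint U * V) $$ (i, j) = col V j \<bullet>c col U i"
  using assms by (auto simp: scalar_prod_def mult.commute)

section \<open>Two-norm and completion to a unitary matrix\<close>

lemma vec_norm2_square: "of_real ((vec_norm2 v)\<^sup>2) = v \<bullet>c v"
proof -
  have "(vec_norm2 v)\<^sup>2 = (\<Sum>i<dim_vec v. (cmod (v $ i))\<^sup>2)"
    by (simp add: vec_norm2_def sum_nonneg)
  then show ?thesis
    by (simp only: of_real_sum complex_norm_square scalar_prod_def)
       (simp add: lessThan_atLeast0)
qed

text \<open>Complete \<open>v\<close> to a basis, apply Gram-Schmidt and normalise. Gram-Schmidt
  keeps its first vector, so the first column stays parallel to \<open>v\<close>; this is what lets
  an eigenvector be split off in the spectral theorem.\<close>

lemma unitary_extension: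
  fixes v :: "complex vec"
  assumes v: "v \<in> carrier_vec n" "v \<noteq> 0\<^sub>v n"
  obtains U c where "U \<in> carrier_mat n n" "mat_adjoint U * U = 1\<^sub>m n" "col U 0 = c \<cdot>\<^sub>v v"
proof -
  interpret cof_vec_space n "TYPE(complex)" .
  note b = basis_completion[OF v]
  have b': "set (basis_completion v) \<subseteq> carrier_vec n" "distinct (basis_completion v)"
    "lin_indpt (set (basis_completion v))" "hd (basis_completion v) = v" "length (basis_completion v) = n"
    using b by auto
  from v have n: "n > 0" by (cases n) auto
  with b'(4,5) obtain vs where bv: "basis_completion v = v # vs"
    by (cases "basis_completion v") auto
  define ws where "ws = gram_schmidt n (basis_completion v)"
  from gram_schmidt_result[OF b'(1-3) ws_def]
  have ws: "set ws \<subseteq> carrier_vec n" "corthogonal ws" "length ws = n"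
    using b' by auto
  have "ws \<noteq> []" using n ws(3) by auto
  then have "ws ! 0 = hd ws" by (rule hd_conv_nth[symmetric])
  also have "\<dots> = v" unfolding ws_def bv by (rule gram_schmidt_hd[OF v(1)])
  finally have hdws: "ws ! 0 = v" .
  define us where "us = map (\<lambda>w. complex_of_real (1 / vec_norm2 w) \<cdot>\<^sub>v w) ws"
  define U where "U = mat_of_cols n us"
  have wsi: "ws ! i \<in> carrier_vec n" if "i < n" for i
    using ws that by auto
  have U: "U \<in> carrier_mat n n"
    using ws by (auto simp: U_def us_def)
  have colU: "col U i = complex_of_real (1 / vec_norm2 (ws ! i)) \<cdot>\<^sub>v ws ! i" if "i < n" for i
    using that wsi[OF that] ws by (auto simp: U_def us_def)
  have "col U j \<bullet>c col U i = (if i = j then 1 else 0)" if "i < n" "j < n" for i j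
  proof -
    have "col U j \<bullet>c col U i = complex_of_real (1 / vec_norm2 (ws ! j)) *
      complex_of_real (1 / vec_norm2 (ws ! i)) * (ws ! j \<bullet>c ws ! i)"
      using that wsi[OF that(1)] wsi[OF that(2)]
      by (simp add: colU conjugate_smult_vec)
    \<comment> \<open>Both directions count: distinct vectors are orthogonal, and each vector has a
      non-zero product with itself, so the normalising factors cancel on the diagonal.\<close>
    moreover have "ws ! j \<bullet>c ws ! i = 0 \<longleftrightarrow> i \<noteq> j"
      using corthogonalD[OF ws(2), of j i] that ws by auto
    moreover have "ws ! i \<bullet>c ws ! i = (complex_of_real (vec_norm2 (ws ! i)))\<^sup>2"
      by (metis of_real_power vec_norm2_square)
    ultimately show ?thesis
      by (auto simp: power2_eq_square)
  qed
  then have "mat_adjoint U * U = 1\<^sub>m n"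
    using U by (intro eq_matI) (auto simp: adjoint_mult_index[OF U U] simp del: index_mult_mat(1))
  with U show thesis
    using that colU[OF n] hdws by metis
qed

section \<open>Spectral theorem for Hermitian matrices\<close>

definition real_diag :: "nat \<Rightarrow> (nat \<Rightarrow> real) \<Rightarrow> complex mat" where
  "real_diag n d = mat n n (\<lambda>(i, j). if i = j then complex_of_real (d i) else 0)"

lemma real_diag_carrier [simp]: "real_diag n d \<in> carrier_mat n n"
  by (simp add: real_diag_def)

text \<open>The eigenvalues form an unordered family of reals of which only the values below
  \<open>n\<close> matter, so sums and maxima over \<open>{..<n}\<close> need no sorting. The
  columns of \<open>U\<close> are an orthonormal eigenbasis.\<close>

definition spectral_decomp :: "nat \<Rightarrow> complex mat \<Rightarrow> (nat \<Rightarrow> real) \<Rightarrow> complex mat \<Rightarrow> bool" where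
  "spectral_decomp n U d A \<longleftrightarrow>
     U \<in> carrier_mat n n \<and> mat_adjoint U * U = 1\<^sub>m n \<and> A = U * real_diag n d * mat_adjoint U"

lemma unitary_right:
  fixes U :: "complex mat"
  assumes "U \<in> carrier_mat n n" "mat_adjoint U * U = 1\<^sub>m n"
  shows "U * mat_adjoint U = 1\<^sub>m n"
  using assms mat_mult_left_right_inverse mat_adjoint_carrier by blast

lemma spectral_decomp_carrier: "spectral_decomp n U d A \<Longrightarrow> A \<in> carrier_mat n n"
  by (auto simp: spectral_decomp_def intro!: mult_carrier_mat)

text \<open>Undoes a unitary change of basis: the induction below diagonalises the conjugated matrix
  and carries the result back to \<open>A\<close>.\<close>

lemma spectral_decomp_conj:
  assumes W: "W \<in> carrier_mat n n" "mat_adjoint W * W = 1\<^sub>m n" and A: "A \<in> carrier_mat n n"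
    and "spectral_decomp n U d (mat_adjoint W * A * W)"
  shows "spectral_decomp n (W * U) d A"
proof -
  let ?D = "real_diag n d"
  note car = W(1) A mat_adjoint_carrier mult_carrier_mat[of _ n n _ n]
  note assoc = assoc_mult_mat[of _ n n _ n _ n]
  from assms(4) have U: "U \<in> carrier_mat n n" "mat_adjoint U * U = 1\<^sub>m n"
    and eq: "mat_adjoint W * A * W = U * ?D * mat_adjoint U"
    by (auto simp: spectral_decomp_def)
  note WW = unitary_right[OF W]
  have 1: "mat_adjoint (W * U) * (W * U) = 1\<^sub>m n"
  proof -
    have "mat_adjoint (W * U) * (W * U) = mat_adjoint U * ((mat_adjoint W * W) * U)"
      using U by (simp add: mat_adjoint_mult[of _ n n _ n] assoc car)
    then show ?thesis using W U by simp
  qed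
  have "A = (W * mat_adjoint W) * A * (W * mat_adjoint W)"
    using WW A by simp
  also have "\<dots> = W * (mat_adjoint W * A * W) * mat_adjoint W"
    by (simp add: assoc car)
  also have "\<dots> = (W * U) * ?D * mat_adjoint (W * U)"
    unfolding eq using U by (simp add: mat_adjoint_mult[of _ n n _ n] assoc car)
  finally show ?thesis
    using 1 W U by (simp add: spectral_decomp_def)
qed

lemma block_diag_mult:
  fixes A B C D :: "'a :: semiring_1 mat"
  assumes "A \<in> carrier_mat m m" "B \<in> carrier_mat m m" "C \<in> carrier_mat n n" "D \<in> carrier_mat n n"
  shows "four_block_mat A (0\<^sub>m m n) (0\<^sub>m n m) C * four_block_mat B (0\<^sub>m m n) (0\<^sub>m n m) D =
    four_block_mat (A * B) (0\<^sub>m m n) (0\<^sub>m n m) (C * D)"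
  using assms by (subst mult_four_block_mat[of _ m m _ n _ n _ _ m _ n]) auto

text \<open>Deflation: in an orthonormal basis that starts with an eigenvector, Hermitian symmetry
  clears the rest of the first row and column, and the induction hypothesis diagonalises the
  remaining block.\<close>

theorem hermitian_spectral_decomp:
  assumes "A \<in> carrier_mat n n" "mat_adjoint A = A"
  shows "\<exists>U d. spectral_decomp n U d A"
  using assms
proof (induction n arbitrary: A)
  case 0
  then have "spectral_decomp 0 A (\<lambda>_. 0) A"
    by (auto simp: spectral_decomp_def intro!: eq_matI)
  then show ?case by blast
next
  case (Suc n)
  let ?N = "Suc n"
  have "degree (char_poly A) = ?N"
    using degree_monic_char_poly[OF Suc.prems(1)] by simp
  \<comment> \<open>The degree \<open>Suc n\<close> is positive, so the characteristic polynomial is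
    not constant and has a complex root.\<close>
  then obtain e where "poly (char_poly A) e = 0"
    using fundamental_theorem_of_algebra[of "char_poly A"] constant_degree[of "char_poly A"] by auto
  then obtain v where "eigenvector A v e"
    using eigenvalue_root_char_poly[OF Suc.prems(1)] eigenvalue_def by blast
  then have v: "v \<in> carrier_vec ?N" "v \<noteq> 0\<^sub>v ?N" and ev: "A *\<^sub>v v = e \<cdot>\<^sub>v v"
    using Suc.prems(1) by (auto simp: eigenvector_def)
  obtain W c where W: "W \<in> carrier_mat ?N ?N" "mat_adjoint W * W = 1\<^sub>m ?N" and col0: "col W 0 = c \<cdot>\<^sub>v v"
    by (rule unitary_extension[OF v])
  define A' where "A' = mat_adjoint W * A * W"
  have A': "A' \<in> carrier_mat ?N ?N"
    using W Suc.prems by (auto simp: A'_def intro!: mult_carrier_mat)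
  have herm: "mat_adjoint A' = A'"
    using W Suc.prems unfolding A'_def
    by (simp add: mat_adjoint_mult[of _ ?N ?N _ ?N] assoc_mult_mat[of _ ?N ?N _ ?N _ ?N] mult_carrier_mat[of _ ?N ?N _ ?N])
  have Acol: "col (A * W) 0 = e \<cdot>\<^sub>v col W 0"
  proof -
    have "col (A * W) 0 = A *\<^sub>v col W 0"
      using W Suc.prems by (intro eq_vecI) auto
    then show ?thesis
      using v Suc.prems ev by (simp add: col0 mult_mat_vec smult_smult_assoc mult.commute)
  qed
  \<comment> \<open>The first column of \<open>W\<close> is an eigenvector and the columns of
    \<open>W\<close> are orthonormal, so the first column of \<open>A'\<close> is \<open>e\<close>
    times the first unit vector.\<close>
  have entry0: "A' $$ (i, 0) = (if i = 0 then e else 0)" if "i < ?N" for i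
  proof -
    have cW: "col W 0 \<in> carrier_vec ?N" "col W i \<in> carrier_vec ?N"
      using W by (auto intro!: carrier_vecI)
    have "A' $$ (i, 0) = (mat_adjoint W * (A * W)) $$ (i, 0)"
      using W Suc.prems by (simp add: A'_def assoc_mult_mat[of _ ?N ?N _ ?N _ ?N])
    also have "\<dots> = col (A * W) 0 \<bullet>c col W i"
      using W Suc.prems that by (intro adjoint_mult_index) (auto intro!: mult_carrier_mat)
    also have "\<dots> = e * (col W 0 \<bullet>c col W i)"
      unfolding Acol using cW by simp
    also have "col W 0 \<bullet>c col W i = 1\<^sub>m ?N $$ (i, 0)"
      using adjoint_mult_index[OF W(1) W(1) that, of 0] W by simp
    finally show ?thesis using that by simp
  qed
  have entry0': "A' $$ (0, i) = (if i = 0 then cnj e else 0)" if "i < ?N" for i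
  proof -
    have "A' $$ (0, i) = cnj (A' $$ (i, 0))"
      using A' that by (subst herm[symmetric]) simp
    then show ?thesis using entry0[OF that] by auto
  qed
  \<comment> \<open>The entry at \<open>(0, 0)\<close> is both \<open>e\<close> and
    \<open>cnj e\<close>, so the eigenvalue is real.\<close>
  have cnj_e: "cnj e = e"
    using entry0[of 0] entry0'[of 0] by simp
  then have e: "complex_of_real (Re e) = e"
    by (simp add: complex_eq_iff)
  define A3 where "A3 = mat n n (\<lambda>(i, j). A' $$ (Suc i, Suc j))"
  have A3: "A3 \<in> carrier_mat n n" by (simp add: A3_def)
  have "mat_adjoint A3 = A3"
  proof (rule eq_matI)
    fix i j assume "i < dim_row A3" "j < dim_col A3"
    then have ij: "i < n" "j < n" using A3 by auto
    have "A' $$ (Suc i, Suc j) = mat_adjoint A' $$ (Suc i, Suc j)"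
      using herm by simp
    also have "\<dots> = cnj (A' $$ (Suc j, Suc i))"
      using A' ij by simp
    finally show "mat_adjoint A3 $$ (i, j) = A3 $$ (i, j)"
      using ij by (simp add: A3_def)
  qed (simp_all add: A3_def)
  from Suc.IH[OF A3 this] obtain U d where U: "U \<in> carrier_mat n n" "mat_adjoint U * U = 1\<^sub>m n"
    and A3eq: "A3 = U * real_diag n d * mat_adjoint U"
    by (auto simp: spectral_decomp_def)
  \<comment> \<open>Index 0 carries the eigenvalue split off; those of the smaller block move up by
    one.\<close>
  define d' where "d' = case_nat (Re e) d"
  define U' where "U' = four_block_mat (1\<^sub>m 1) (0\<^sub>m 1 n) (0\<^sub>m n 1) U"
  have U'adj: "mat_adjoint U' = four_block_mat (1\<^sub>m 1) (0\<^sub>m 1 n) (0\<^sub>m n 1) (mat_adjoint U)"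
    unfolding U'_def using U by (subst mat_adjoint_four_block) auto
  have diag: "real_diag ?N d' = four_block_mat (real_diag 1 (\<lambda>_. Re e)) (0\<^sub>m 1 n) (0\<^sub>m n 1) (real_diag n d)"
    by (rule eq_matI) (auto simp: real_diag_def d'_def split: nat.splits)
  have A'block: "A' = four_block_mat (real_diag 1 (\<lambda>_. Re e)) (0\<^sub>m 1 n) (0\<^sub>m n 1) A3"
    using A' entry0 entry0' e cnj_e by (intro eq_matI) (auto simp: A3_def real_diag_def)
  have "spectral_decomp ?N U' d' A'"
    unfolding spectral_decomp_def
  proof (intro conjI)
    show "U' \<in> carrier_mat ?N ?N"
      using four_block_carrier_mat[of "1\<^sub>m 1" 1 1 U n n] U by (simp add: U'_def)
    have [simp]: "four_block_mat (1\<^sub>m 1) (0\<^sub>m 1 n) (0\<^sub>m n 1) (1\<^sub>m n) = (1\<^sub>m ?N :: complex mat)"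
      by (rule eq_matI) auto
    show "mat_adjoint U' * U' = 1\<^sub>m ?N"
      unfolding U'adj unfolding U'_def using U by (simp add: block_diag_mult)
    show "A' = U' * real_diag ?N d' * mat_adjoint U'"
      unfolding U'adj diag A'block A3eq unfolding U'_def using U
      by (simp add: block_diag_mult[of _ 1 _ _ n] mult_carrier_mat[of _ n n _ n] left_mult_one_mat[of _ 1 1]
        right_mult_one_mat[of _ 1 1] del: One_nat_def)
  qed
  then show ?case
    using spectral_decomp_conj[OF W Suc.prems(1)] unfolding A'_def by blast
qed

section \<open>Convexity of powers and Minkowski's inequality\<close>

text \<open>For two positive points this is \<open>powr_convex\<close>. If one point is 0, the claim
  becomes \<open>(s * z) powr p \<le> s * z powr p\<close>, which holds because
  \<open>s powr p \<le> s\<close> for \<open>s\<close> between 0 and 1.\<close>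

lemma convex_on_powr_nonneg:
  assumes "1 \<le> p"
  shows "convex_on {0..} (\<lambda>x::real. x powr p)"
proof (rule convex_onI)
  fix t x y :: real
  assume t: "0 < t" "t < 1" and xy: "x \<in> {0..}" "y \<in> {0..}"
  have le: "(s * z) powr p \<le> s * z powr p" if "0 < s" "s < 1" "0 \<le> z" for s z :: real
  proof -
    have "s powr p \<le> s powr 1" using that assms by (intro powr_mono') auto
    then have "s powr p * z powr p \<le> s * z powr p" using that by (intro mult_right_mono) auto
    then show ?thesis using that by (simp add: powr_mult)
  qed
  consider "x = 0" | "y = 0" | "x > 0" "y > 0" using xy by force
  then show "((1 - t) *\<^sub>R x + t *\<^sub>R y) powr p \<le> (1 - t) * x powr p + t * y powr p"
  proof cases
    case 1
    then show ?thesis using le[of t y] t xy by simp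
  next
    case 2
    then show ?thesis using le[of "1 - t" x] t xy by simp
  next
    case 3
    then show ?thesis using convex_onD[OF powr_convex[OF assms], of t x y] t by simp
  qed
qed simp

text \<open>With \<open>a\<close> and \<open>b\<close> the two norms,
  \<open>(x i + y i) / (a + b)\<close> is the convex combination of \<open>x i / a\<close> and
  \<open>y i / b\<close> with weights \<open>a / (a + b)\<close> and \<open>b / (a + b)\<close>.
  Convexity of the power, summed over \<open>i\<close>, bounds the power sum of these quotients by
  1.\<close>

lemma minkowski_sum:
  fixes x y :: "'a \<Rightarrow> real"
  assumes "finite I" "1 \<le> p" and x: "\<And>i. i \<in> I \<Longrightarrow> 0 \<le> x i" and y: "\<And>i. i \<in> I \<Longrightarrow> 0 \<le> y i"
  shows "(\<Sum>i\<in>I. (x i + y i) powr p) powr (1 / p) \<le>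
    (\<Sum>i\<in>I. x i powr p) powr (1 / p) + (\<Sum>i\<in>I. y i powr p) powr (1 / p)"
proof -
  define a where "a = (\<Sum>i\<in>I. x i powr p) powr (1 / p)"
  define b where "b = (\<Sum>i\<in>I. y i powr p) powr (1 / p)"
  have ap: "a powr p = (\<Sum>i\<in>I. x i powr p)" and bp: "b powr p = (\<Sum>i\<in>I. y i powr p)"
    using assms by (auto simp: a_def b_def powr_powr sum_nonneg)
  have "a \<ge> 0" "b \<ge> 0" by (auto simp: a_def b_def)
  \<comment> \<open>A vanishing norm forces its whole family to vanish and makes the claim an
    equality; the remaining case may divide by \<open>a\<close> and \<open>b\<close>.\<close>
  then consider "a = 0" | "b = 0" | "a > 0" "b > 0" by linarith
  then show ?thesis
  proof cases
    case 1
    then have "\<forall>i\<in>I. x i = 0"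
      using ap assms by (simp add: sum_nonneg_eq_0_iff)
    then show ?thesis by simp
  next
    case 2
    then have "\<forall>i\<in>I. y i = 0"
      using bp assms by (simp add: sum_nonneg_eq_0_iff)
    then show ?thesis by simp
  next
    case 3
    define t where "t = b / (a + b)"
    have t: "0 \<le> t" "t \<le> 1" "1 - t = a / (a + b)"
      using 3 by (auto simp: t_def field_simps)
    have "((x i + y i) / (a + b)) powr p \<le> (1 - t) * (x i powr p / a powr p) + t * (y i powr p / b powr p)"
      if "i \<in> I" for i
    proof -
      have "(x i + y i) / (a + b) = (1 - t) * (x i / a) + t * (y i / b)"
        unfolding t(3) using 3 by (simp add: t_def add_divide_distrib)
      then show ?thesis
        using convex_onD[OF convex_on_powr_nonneg[OF assms(2)], of t "x i / a" "y i / b"] t(1,2) 3 x[OF that] y[OF that]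
        by (simp add: powr_divide)
    qed
    then have "(\<Sum>i\<in>I. ((x i + y i) / (a + b)) powr p) \<le>
        (\<Sum>i\<in>I. (1 - t) * (x i powr p / a powr p) + t * (y i powr p / b powr p))"
      by (rule sum_mono)
    also have "\<dots> = (1 - t) * ((\<Sum>i\<in>I. x i powr p) / a powr p) + t * ((\<Sum>i\<in>I. y i powr p) / b powr p)"
      by (simp add: sum.distrib sum_distrib_left sum_divide_distrib)
    also have "\<dots> = 1"
      using 3 unfolding ap[symmetric] bp[symmetric] by simp
    also have "(\<Sum>i\<in>I. ((x i + y i) / (a + b)) powr p) = (\<Sum>i\<in>I. (x i + y i) powr p) / (a + b) powr p"
      using 3 x y by (simp add: powr_divide sum_divide_distrib)
    finally have "(\<Sum>i\<in>I. (x i + y i) powr p) \<le> (a + b) powr p"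
      using 3 by (simp add: field_simps)
    then have "(\<Sum>i\<in>I. (x i + y i) powr p) powr (1 / p) \<le> ((a + b) powr p) powr (1 / p)"
      using assms by (intro powr_mono2) (auto intro: sum_nonneg)
    also have "\<dots> = a + b"
      using 3 assms by (simp add: powr_powr)
    finally show ?thesis by (simp add: a_def b_def)
  qed
qed

section \<open>Inner products, norms and unitary matrices\<close>

lemma mult_mat_vec_cscalar_adjoint:
  fixes A :: "complex mat"
  assumes "A \<in> carrier_mat m n" "v \<in> carrier_vec n" "w \<in> carrier_vec m"
  shows "(A *\<^sub>v v) \<bullet>c w = v \<bullet>c (mat_adjoint A *\<^sub>v w)"
proof -
  have "(A *\<^sub>v v) \<bullet>c w = (\<Sum>i<m. \<Sum>j<n. A $$ (i, j) * v $ j * cnj (w $ i))"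
    using assms by (simp add: scalar_prod_def sum_distrib_right lessThan_atLeast0)
  also have "\<dots> = (\<Sum>j<n. \<Sum>i<m. A $$ (i, j) * v $ j * cnj (w $ i))"
    by (rule sum.swap)
  also have "\<dots> = v \<bullet>c (mat_adjoint A *\<^sub>v w)"
    using assms by (simp add: scalar_prod_def sum_distrib_left lessThan_atLeast0 ac_simps)
  finally show ?thesis .
qed

lemma vec_norm2_nonneg: "0 \<le> vec_norm2 v"
  by (simp add: vec_norm2_def sum_nonneg)

lemma vec_norm2_unitary:
  fixes U :: "complex mat"
  assumes "U \<in> carrier_mat n n" "mat_adjoint U * U = 1\<^sub>m n" "v \<in> carrier_vec n"
  shows "vec_norm2 (U *\<^sub>v v) = vec_norm2 v"
proof -
  have "(U *\<^sub>v v) \<bullet>c (U *\<^sub>v v) = v \<bullet>c ((mat_adjoint U * U) *\<^sub>v v)"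
    using assms(1,3) mult_mat_vec_cscalar_adjoint[OF assms(1,3), of "U *\<^sub>v v"]
    by (simp add: assoc_mult_mat_vec[of _ n n _ n] mult_mat_vec_carrier[of _ n n])
  then have "(U *\<^sub>v v) \<bullet>c (U *\<^sub>v v) = v \<bullet>c v"
    using assms by simp
  then have "(vec_norm2 (U *\<^sub>v v))\<^sup>2 = (vec_norm2 v)\<^sup>2"
    unfolding vec_norm2_square[symmetric] of_real_eq_iff .
  then show ?thesis
    using vec_norm2_nonneg by (simp add: power2_eq_iff_nonneg)
qed

lemma mat_adjoint_mult_col:
  assumes "U \<in> carrier_mat n n" "mat_adjoint U * U = 1\<^sub>m n" "k < n"
  shows "mat_adjoint U *\<^sub>v col U k = unit_vec n k"
proof -
  have "mat_adjoint U *\<^sub>v col U k = col (mat_adjoint U * U) k"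
    using assms(1,3) by (intro eq_vecI) auto
  then show ?thesis using assms by simp
qed

lemma mult_mat_unit_vec:
  fixes A :: "'a :: semiring_1 mat"
  assumes "A \<in> carrier_mat m n" "k < n"
  shows "A *\<^sub>v unit_vec n k = col A k"
  using assms by (intro eq_vecI) (auto simp: scalar_prod_right_unit)

lemma vec_norm2_unit_vec: "k < n \<Longrightarrow> vec_norm2 (unit_vec n k) = 1"
  by (simp add: vec_norm2_def if_distrib[of "\<lambda>x. (cmod x)\<^sup>2"] cong: if_cong)

lemma vec_norm2_col_unitary:
  assumes "U \<in> carrier_mat n n" "mat_adjoint U * U = 1\<^sub>m n" "k < n"
  shows "vec_norm2 (col U k) = 1"
  using vec_norm2_unitary[OF assms(1,2), of "unit_vec n k"] assms
  by (simp add: mult_mat_unit_vec[of _ n n] vec_norm2_unit_vec)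

lemma real_diag_mult_vec:
  assumes "w \<in> carrier_vec n"
  shows "real_diag n d *\<^sub>v w = vec n (\<lambda>i. complex_of_real (d i) * w $ i)"
  using assms
  by (intro eq_vecI) (auto simp: real_diag_def scalar_prod_def if_distrib[of "\<lambda>x. x * _"] cong: if_cong)

section \<open>Forms, norms and characteristic polynomial from a spectral decomposition\<close>

context
  fixes n U d A
  assumes S: "spectral_decomp n U d A"
begin

private lemma U: "U \<in> carrier_mat n n" "mat_adjoint U * U = 1\<^sub>m n"
  and A_eq: "A = U * real_diag n d * mat_adjoint U"
  using S by (auto simp: spectral_decomp_def)

private lemma A: "A \<in> carrier_mat n n"
  by (rule spectral_decomp_carrier[OF S])

lemma spectral_mult_vec:
  assumes "v \<in> carrier_vec n"
  shows "A *\<^sub>v v = U *\<^sub>v (real_diag n d *\<^sub>v (mat_adjoint U *\<^sub>v v))"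
  using assms U(1) mult_carrier_mat[of _ n n _ n] unfolding A_eq
  by (simp add: assoc_mult_mat_vec[of _ n n _ n] mult_mat_vec_carrier[of _ n n])

text \<open>In the coordinates \<open>mat_adjoint U *\<^sub>v v\<close> of the eigenbasis the form
  is diagonal.\<close>

lemma spectral_quadratic_form:
  assumes v: "v \<in> carrier_vec n"
  shows "Re ((A *\<^sub>v v) \<bullet>c v) = (\<Sum>j<n. d j * (cmod ((mat_adjoint U *\<^sub>v v) $ j))\<^sup>2)"
proof -
  define w where "w = mat_adjoint U *\<^sub>v v"
  have w: "w \<in> carrier_vec n" using U v by (auto simp: w_def intro!: mult_mat_vec_carrier)
  have "(A *\<^sub>v v) \<bullet>c v = (U *\<^sub>v (real_diag n d *\<^sub>v w)) \<bullet>c v"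
    using spectral_mult_vec[OF v] by (simp add: w_def)
  also have "\<dots> = (real_diag n d *\<^sub>v w) \<bullet>c w"
    unfolding w_def by (rule mult_mat_vec_cscalar_adjoint[OF U(1) _ v])
      (use U v in \<open>auto intro!: mult_mat_vec_carrier[of _ n n]\<close>)
  also have "\<dots> = (\<Sum>j<n. complex_of_real (d j) * (w $ j * cnj (w $ j)))"
    using w by (simp add: real_diag_mult_vec scalar_prod_def lessThan_atLeast0 mult.assoc)
  also have "\<dots> = of_real (\<Sum>j<n. d j * (cmod (w $ j))\<^sup>2)"
    by (simp del: of_real_power add: complex_norm_square)
  finally show ?thesis by (simp add: w_def)
qed

text \<open>Column \<open>k\<close> has the coordinates of a unit vector, so only \<open>d k\<close>
  survives. Eigenvalues are thereby read off as values of the form.\<close>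

lemma spectral_quadratic_form_col:
  assumes "k < n"
  shows "Re ((A *\<^sub>v col U k) \<bullet>c col U k) = d k"
proof -
  have "col U k \<in> carrier_vec n" using U(1) by (auto intro!: carrier_vecI)
  then show ?thesis
    using assms by (simp add: spectral_quadratic_form mat_adjoint_mult_col[OF U]
      if_distrib[of "\<lambda>x. _ * (cmod x)\<^sup>2"] cong: if_cong)
qed

text \<open>Parseval's identity for the orthonormal basis of columns of \<open>U\<close>.\<close>

lemma vec_norm2_adjoint_mult:
  assumes "v \<in> carrier_vec n"
  shows "(\<Sum>j<n. (cmod ((mat_adjoint U *\<^sub>v v) $ j))\<^sup>2) = (vec_norm2 v)\<^sup>2"
proof -
  have "vec_norm2 (mat_adjoint U *\<^sub>v v) = vec_norm2 v"
    using U assms by (intro vec_norm2_unitary[of _ n]) (auto simp: unitary_right)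
  then have "(vec_norm2 v)\<^sup>2 = (vec_norm2 (mat_adjoint U *\<^sub>v v))\<^sup>2" by simp
  also have "\<dots> = (\<Sum>j<n. (cmod ((mat_adjoint U *\<^sub>v v) $ j))\<^sup>2)"
    unfolding vec_norm2_def using U(1) by (simp add: sum_nonneg)
  finally show ?thesis by simp
qed

lemma spectral_norm_mult_vec:
  assumes v: "v \<in> carrier_vec n"
  shows "(vec_norm2 (A *\<^sub>v v))\<^sup>2 = (\<Sum>j<n. (d j)\<^sup>2 * (cmod ((mat_adjoint U *\<^sub>v v) $ j))\<^sup>2)"
proof -
  have w: "mat_adjoint U *\<^sub>v v \<in> carrier_vec n"
    using U v by (auto intro!: mult_mat_vec_carrier)
  then have "vec_norm2 (A *\<^sub>v v) = vec_norm2 (real_diag n d *\<^sub>v (mat_adjoint U *\<^sub>v v))"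
    unfolding spectral_mult_vec[OF v]
    by (intro vec_norm2_unitary[OF U]) (auto intro!: mult_mat_vec_carrier[of _ n n])
  then show ?thesis
    unfolding real_diag_mult_vec[OF w]
    by (simp add: vec_norm2_def sum_nonneg norm_mult power_mult_distrib)
qed

text \<open>The supremum is attained at a column of \<open>U\<close> that belongs to the largest
  eigenvalue; Parseval's identity gives the upper bound. Nonnegativity of \<open>d\<close> makes the
  maximum of \<open>d\<close>, rather than of its absolute values, the right one.\<close>

lemma op_norm2_spectral:
  assumes "0 < n" and d: "\<And>i. i < n \<Longrightarrow> 0 \<le> d i"
  shows "op_norm2 A = Max (d ` {..<n})"
  unfolding op_norm2_def
proof (rule cSup_eq_maximum)
  let ?m = "Max (d ` {..<n})"
  have "?m \<in> d ` {..<n}" using assms(1) by (intro Max_in) auto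
  then obtain k where k: "k < n" "?m = d k" by auto
  have c: "col U k \<in> carrier_vec n" using U(1) by (auto intro!: carrier_vecI)
  have "vec_norm2 (col U k) = 1"
    by (rule vec_norm2_col_unitary[OF U k(1)])
  moreover have "(vec_norm2 (A *\<^sub>v col U k))\<^sup>2 = (d k)\<^sup>2"
    using c k by (simp add: spectral_norm_mult_vec mat_adjoint_mult_col[OF U]
      if_distrib[of "\<lambda>x. _ * (cmod x)\<^sup>2"] cong: if_cong)
  then have "vec_norm2 (A *\<^sub>v col U k) = d k"
    using vec_norm2_nonneg d[OF k(1)] by (simp add: power2_eq_iff_nonneg)
  ultimately show "?m \<in> (\<lambda>v. vec_norm2 (A *\<^sub>v v)) ` {v \<in> carrier_vec (dim_col A). vec_norm2 v \<le> 1}"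
    using A c k by (intro image_eqI[of _ _ "col U k"]) auto
  fix x assume "x \<in> (\<lambda>v. vec_norm2 (A *\<^sub>v v)) ` {v \<in> carrier_vec (dim_col A). vec_norm2 v \<le> 1}"
  then obtain v where v: "v \<in> carrier_vec n" "vec_norm2 v \<le> 1" and x: "x = vec_norm2 (A *\<^sub>v v)"
    using A by auto
  have m: "0 \<le> ?m" using k d by simp
  have "x\<^sup>2 \<le> (\<Sum>j<n. ?m\<^sup>2 * (cmod ((mat_adjoint U *\<^sub>v v) $ j))\<^sup>2)"
    unfolding x spectral_norm_mult_vec[OF v(1)]
    using d by (intro sum_mono mult_right_mono power_mono) auto
  also have "\<dots> = ?m\<^sup>2 * (vec_norm2 v)\<^sup>2"
    by (simp add: sum_distrib_left[symmetric] vec_norm2_adjoint_mult[OF v(1)])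
  also have "\<dots> \<le> ?m\<^sup>2 * 1"
    using v vec_norm2_nonneg by (intro mult_left_mono) (auto simp: power_le_one)
  finally show "x \<le> ?m"
    using m by - (rule power2_le_imp_le, simp_all)
qed

text \<open>\<open>A\<close> is similar to a diagonal matrix, in particular to an upper triangular
  one, whose characteristic polynomial is read off the diagonal.\<close>

lemma char_poly_spectral: "char_poly A = (\<Prod>a\<leftarrow>map (\<lambda>i. complex_of_real (d i)) [0..<n]. [:- a, 1:])"
proof -
  have "similar_mat A (real_diag n d)"
    unfolding similar_mat_def
    using similar_mat_witI[OF unitary_right[OF U] U(2) A_eq A real_diag_carrier U(1)
      mat_adjoint_carrier[OF U(1)]] by blast
  then have "char_poly A = char_poly (real_diag n d)" by (rule char_poly_similar)
  also have "\<dots> = (\<Prod>a\<leftarrow>diag_mat (real_diag n d). [:- a, 1:])"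
    by (rule char_poly_upper_triangular[of _ n]) (auto simp: real_diag_def)
  also have "diag_mat (real_diag n d) = map (\<lambda>i. complex_of_real (d i)) [0..<n]"
    by (auto simp: diag_mat_def real_diag_def)
  finally show ?thesis .
qed

text \<open>The inner unitary factors cancel and the real diagonal is self-adjoint, so the
  eigenbasis is kept and the eigenvalues are squared. This is the matrix from which
  \<open>singular_values\<close> is computed.\<close>

lemma spectral_adjoint_mult_self: "spectral_decomp n U (\<lambda>i. (d i)\<^sup>2) (mat_adjoint A * A)"
proof -
  let ?D = "real_diag n d"
  have D: "mat_adjoint ?D = ?D" "?D * ?D = real_diag n (\<lambda>i. (d i)\<^sup>2)"
    by (rule eq_matI; auto simp: real_diag_def scalar_prod_def power2_eq_square
      if_distrib[of "\<lambda>x. x * _"] cong: if_cong)+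
  note [simp] = mult_carrier_mat[of _ n n _ n] assoc_mult_mat[of _ n n _ n _ n]
    mat_adjoint_mult[of _ n n _ n]
  have "mat_adjoint A * A = U * (?D * ((mat_adjoint U * U) * (?D * mat_adjoint U)))"
    unfolding A_eq using U(1) by (simp add: D del: U(2))
  also have "\<dots> = U * (?D * ?D) * mat_adjoint U"
    unfolding U(2) using U(1) by (simp add: left_mult_one_mat[of _ n n])
  finally show ?thesis
    using U by (simp add: spectral_decomp_def D)
qed

end

section \<open>Singular values and stable rank in terms of eigenvalues\<close>

lemma proots_prod_linear_factors: "proots (\<Prod>a\<leftarrow>as. [:- a, 1:]) = mset (as :: complex list)"
proof (induction as)
  case (Cons a as)
  have "(\<Prod>a\<leftarrow>as. [:- a, 1:]) \<noteq> 0" by (auto simp: prod_list_zero_iff)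
  then have "proots ([:- a, 1:] * (\<Prod>a\<leftarrow>as. [:- a, 1:])) = add_mset a (mset as)"
    by (subst proots_mult) (use Cons.IH in auto)
  then show ?case by (simp del: mult_pCons_left)
qed simp

text \<open>The eigenvalues of \<open>mat_adjoint A * A\<close> are the squares of the
  \<open>d i\<close>, and the square root recovers \<open>d i\<close> because it is nonnegative. As
  \<open>A\<close> is square, \<open>take\<close> keeps all \<open>n\<close> entries.\<close>

lemma singular_values_spectral:
  assumes S: "spectral_decomp n U d A" and d: "\<And>i. i < n \<Longrightarrow> 0 \<le> d i"
  shows "singular_values A = rev (sort (map d [0..<n]))"
proof -
  have A: "A \<in> carrier_mat n n" by (rule spectral_decomp_carrier[OF S])
  have "image_mset (\<lambda>z. sqrt (Re z)) (proots (char_poly (mat_adjoint A * A))) =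
      mset (map (\<lambda>i. sqrt ((d i)\<^sup>2)) [0..<n])"
    unfolding char_poly_spectral[OF spectral_adjoint_mult_self[OF S]] proots_prod_linear_factors
    by (simp add: image_mset.compositionality o_def)
  also have "map (\<lambda>i. sqrt ((d i)\<^sup>2)) [0..<n] = map d [0..<n]"
    using d by simp
  finally show ?thesis
    using A by (simp add: singular_values_def sorted_list_of_multiset_mset del: mset_map)
qed

lemma spectral_decomp_psd_nonneg:
  assumes S: "spectral_decomp n U d A" and "hermitian_psd A" and "i < n"
  shows "0 \<le> d i"
proof -
  have "U \<in> carrier_mat n n" "A \<in> carrier_mat n n"
    using S spectral_decomp_carrier[OF S] by (auto simp: spectral_decomp_def)
  then have "col U i \<in> carrier_vec (dim_col A)" by (auto intro!: carrier_vecI)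
  then show ?thesis
    using assms spectral_quadratic_form_col[OF S \<open>i < n\<close>] unfolding hermitian_psd_def by metis
qed

text \<open>If all eigenvalues vanished, so would the diagonal factor and hence \<open>A\<close>; a
  non-zero eigenvalue is positive by semi-definiteness.\<close>

lemma Max_eigenvalue_pos:
  assumes S: "spectral_decomp n U d A" and "hermitian_psd A" and "A \<noteq> 0\<^sub>m n n"
  shows "0 < Max (d ` {..<n})"
proof -
  have "\<exists>i<n. d i \<noteq> 0"
  proof (rule ccontr)
    assume "\<not> ?thesis"
    then have "real_diag n d = 0\<^sub>m n n" by (auto simp: real_diag_def intro!: eq_matI)
    with assms show False by (auto simp: spectral_decomp_def)
  qed
  then obtain i where i: "i < n" "d i \<noteq> 0" by blast
  then have "0 < d i" using spectral_decomp_psd_nonneg[OF S assms(2)] by force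
  also have "d i \<le> Max (d ` {..<n})" using i by (intro Max_ge) auto
  finally show ?thesis .
qed

text \<open>Reduces the root to eigenvalues: for finite \<open>p\<close> it is the quotient of their
  power norm and their maximum, and for infinite \<open>p\<close> both norms are that
  maximum.\<close>

lemma stable_rank_root_spectral:
  assumes S: "spectral_decomp n U d A" and d: "\<And>i. i < n \<Longrightarrow> 0 \<le> d i" and pos: "0 < Max (d ` {..<n})"
    and "0 < n" and p: "1 \<le> p"
  shows "stable_rank_root p A =
    (if p = \<infinity> then 1
     else (\<Sum>i<n. d i powr real_of_ereal p) powr (1 / real_of_ereal p) / Max (d ` {..<n}))"
proof -
  have op: "op_norm2 A = Max (d ` {..<n})" using op_norm2_spectral[OF S \<open>0 < n\<close>] d .
  have sv: "singular_values A = rev (sort (map d [0..<n]))" using singular_values_spectral[OF S] d .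
  have A: "A \<in> carrier_mat n n" by (rule spectral_decomp_carrier[OF S])
  show ?thesis
  proof (cases "p = \<infinity>")
    case True
    let ?l = "sort (map d [0..<n])"
    have ne: "?l \<noteq> []" using \<open>0 < n\<close> by (simp flip: length_0_conv)
    \<comment> \<open>The reversed list starts with the last entry of the ascending one, so this is
      the largest singular value.\<close>
    have "last ?l = Max (set ?l)"
    proof (rule Max_eqI[symmetric])
      fix y assume "y \<in> set ?l"
      then obtain i where "i < length ?l" "y = ?l ! i" by (metis in_set_conv_nth)
      then show "y \<le> last ?l"
        unfolding last_conv_nth[OF ne] by (auto intro!: sorted_nth_mono)
    qed (use last_in_set[OF ne] in auto)
    also have "set ?l = d ` {..<n}" by (auto simp: lessThan_atLeast0)
    finally have "hd (singular_values A) = Max (d ` {..<n})"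
      unfolding sv using ne by (simp add: hd_rev)
    then show ?thesis
      using True pos by (simp add: stable_rank_root_def schatten_norm_def op)
  next
    case False
    define r where "r = real_of_ereal p"
    have r: "1 \<le> r" using p False by (cases p) (auto simp: r_def)
    define s where "s = (\<Sum>i<n. d i powr r) powr (1 / r)"
    have "0 \<le> s" by (simp add: s_def)
    have "mset (singular_values A) = image_mset d (mset_set {..<n})"
      unfolding sv by (simp add: lessThan_atLeast0)
    then have "(\<Sum>\<sigma>\<leftarrow>singular_values A. \<sigma> powr r) = (\<Sum>i<n. d i powr r)"
      by (simp add: sum_mset_sum_list[symmetric] image_mset.compositionality o_def sum_unfold_sum_mset)
    then have "schatten_norm p A = s"
      using False by (simp add: schatten_norm_def s_def r_def)
    \<comment> \<open>The zero matrix has stable rank 0 by convention, so it must be excluded before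
      the quotient formula applies; all its eigenvalues would be 0, against
      \<open>pos\<close>.\<close>
    moreover have "A \<noteq> 0\<^sub>m (dim_row A) (dim_col A)"
    proof
      assume "A = 0\<^sub>m (dim_row A) (dim_col A)"
      with A have A0: "A = 0\<^sub>m n n" by simp
      have U: "U \<in> carrier_mat n n" using S by (simp add: spectral_decomp_def)
      have "d i = 0" if "i < n" for i
        using spectral_quadratic_form_col[OF S that] U that
        by (simp add: A0 scalar_prod_def)
      then have "d ` {..<n} = {0}" using \<open>0 < n\<close> by auto
      with pos show False by simp
    qed
    ultimately have "stable_rank_root p A = (s powr r / Max (d ` {..<n}) powr r) powr (1 / r)"
      using False by (simp add: stable_rank_root_def stable_rank_def op r_def)
    also have "\<dots> = s / Max (d ` {..<n})"
      using r pos \<open>0 \<le> s\<close> by (simp add: powr_divide powr_powr)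
    finally show ?thesis using False by (simp add: s_def r_def)
  qed
qed

text \<open>The numbers \<open>|W\<^sub>j\<^sub>i|\<^sup>2\<close> with \<open>W = V\<^sup>* U\<close> form a doubly stochastic matrix, so each diagonal
  entry of \<open>U\<^sup>* A U\<close> is a mean of eigenvalues of \<open>A\<close> and Jensen's inequality applies.\<close>

lemma sum_powr_diagonal_le:
  assumes S: "spectral_decomp n V a A" and a: "\<And>j. j < n \<Longrightarrow> 0 \<le> a j"
    and U: "U \<in> carrier_mat n n" "mat_adjoint U * U = 1\<^sub>m n" and p: "1 \<le> p"
  shows "(\<Sum>i<n. Re ((A *\<^sub>v col U i) \<bullet>c col U i) powr p) \<le> (\<Sum>j<n. a j powr p)"
\<comment> \<open>Jensen's inequality is applied over a nonempty index set.\<close>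
proof (cases "n = 0")
  case False
  have V: "V \<in> carrier_mat n n" "mat_adjoint V * V = 1\<^sub>m n"
    using S by (auto simp: spectral_decomp_def)
  define P where "P i j = (cmod ((mat_adjoint V *\<^sub>v col U i) $ j))\<^sup>2" for i j
  have colU: "col U i \<in> carrier_vec n" and colV: "col V i \<in> carrier_vec n" for i
    using U V by (auto intro!: carrier_vecI)
  have P_sum: "(\<Sum>j<n. P i j) = 1" if "i < n" for i
    unfolding P_def vec_norm2_adjoint_mult[OF S colU] by (simp add: vec_norm2_col_unitary[OF U that])
  \<comment> \<open>\<open>mat_adjoint U * V\<close> is the adjoint of
    \<open>mat_adjoint V * U\<close>, so \<open>P i j\<close> is also a squared coordinate of a
    column of \<open>V\<close> in the basis \<open>U\<close>. Parseval's identity then gives the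
    sums over \<open>i\<close>.\<close>
  have P_swap: "P i j = (cmod ((mat_adjoint U *\<^sub>v col V j) $ i))\<^sup>2" if "i < n" "j < n" for i j
  proof -
    have "(mat_adjoint U *\<^sub>v col V j) $ i = cnj ((mat_adjoint V *\<^sub>v col U i) $ j)"
      using U V that by (simp add: scalar_prod_def mult.commute)
    then show ?thesis by (simp add: P_def)
  qed
  \<comment> \<open>Zero eigenvalues give a trivial decomposition with basis \<open>U\<close>, so
    that Parseval's identity can be invoked for \<open>U\<close>.\<close>
  have SU: "spectral_decomp n U (\<lambda>_. 0) (U * real_diag n (\<lambda>_. 0) * mat_adjoint U)"
    using U by (simp add: spectral_decomp_def)
  have P_sum': "(\<Sum>i<n. P i j) = 1" if "j < n" for j
    using vec_norm2_adjoint_mult[OF SU colV] vec_norm2_col_unitary[OF V that] P_swap that by simp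
  have "Re ((A *\<^sub>v col U i) \<bullet>c col U i) powr p \<le> (\<Sum>j<n. P i j * a j powr p)" if "i < n" for i
  proof -
    have "Re ((A *\<^sub>v col U i) \<bullet>c col U i) = (\<Sum>j<n. P i j *\<^sub>R a j)"
      by (simp add: spectral_quadratic_form[OF S colU] P_def mult.commute)
    moreover have "(\<Sum>j<n. P i j *\<^sub>R a j) powr p \<le> (\<Sum>j<n. P i j * a j powr p)"
      by (rule convex_on_sum[OF _ _ convex_on_powr_nonneg[OF p]])
        (use False a P_sum[OF that] in \<open>auto simp: P_def\<close>)
    ultimately show ?thesis by simp
  qed
  then have "(\<Sum>i<n. Re ((A *\<^sub>v col U i) \<bullet>c col U i) powr p) \<le> (\<Sum>i<n. \<Sum>j<n. P i j * a j powr p)"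
    by (intro sum_mono) simp
  also have "\<dots> = (\<Sum>j<n. (\<Sum>i<n. P i j) * a j powr p)"
    by (subst sum.swap) (simp add: sum_distrib_right)
  also have "\<dots> = (\<Sum>j<n. a j powr p)"
    using P_sum' by simp
  finally show ?thesis .
qed simp

section \<open>Monotonicity of the largest eigenvalue and the Schatten triangle inequality\<close>

text \<open>Test the form of \<open>C\<close> on a unit eigenvector of \<open>A\<close>: its value
  is at least the eigenvalue of \<open>A\<close>, and at most the largest eigenvalue of
  \<open>C\<close>, being a weighted mean of the eigenvalues of \<open>C\<close>.\<close>

lemma Max_eigenvalue_mono:
  assumes SA: "spectral_decomp n V a A" and SC: "spectral_decomp n U c C" and "0 < n"
    and le: "\<And>v. v \<in> carrier_vec n \<Longrightarrow> Re ((A *\<^sub>v v) \<bullet>c v) \<le> Re ((C *\<^sub>v v) \<bullet>c v)"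
  shows "Max (a ` {..<n}) \<le> Max (c ` {..<n})"
proof (rule Max.boundedI)
  fix x assume "x \<in> a ` {..<n}"
  then obtain j where j: "j < n" "x = a j" by auto
  have V: "V \<in> carrier_mat n n" "mat_adjoint V * V = 1\<^sub>m n"
    using SA by (auto simp: spectral_decomp_def)
  define v where "v = col V j"
  have v: "v \<in> carrier_vec n" using V by (auto simp: v_def intro!: carrier_vecI)
  have "vec_norm2 v = 1"
    unfolding v_def by (rule vec_norm2_col_unitary[OF V j(1)])
  have "x \<le> Re ((C *\<^sub>v v) \<bullet>c v)"
    using le[OF v] spectral_quadratic_form_col[OF SA j(1)] j by (simp add: v_def)
  also have "\<dots> \<le> (\<Sum>i<n. Max (c ` {..<n}) * (cmod ((mat_adjoint U *\<^sub>v v) $ i))\<^sup>2)"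
    unfolding spectral_quadratic_form[OF SC v] by (intro sum_mono mult_right_mono) auto
  also have "\<dots> = Max (c ` {..<n})"
    by (simp add: sum_distrib_left[symmetric] vec_norm2_adjoint_mult[OF SC v] \<open>vec_norm2 v = 1\<close>)
  finally show "x \<le> Max (c ` {..<n})" .
qed (use \<open>0 < n\<close> in auto)

lemma quadratic_form_add:
  fixes A B :: "complex mat"
  assumes "A \<in> carrier_mat n n" "B \<in> carrier_mat n n" "v \<in> carrier_vec n"
  shows "Re (((A + B) *\<^sub>v v) \<bullet>c v) = Re ((A *\<^sub>v v) \<bullet>c v) + Re ((B *\<^sub>v v) \<bullet>c v)"
  using assms mult_mat_vec_carrier[of A n n v] mult_mat_vec_carrier[of B n n v]
  by (simp add: add_mult_distrib_mat_vec[of _ n n] add_scalar_prod_distrib[of _ n])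

theorem schatten_triangle_spectral:
  assumes SA: "spectral_decomp n V a A" and SB: "spectral_decomp n W b B"
    and SC: "spectral_decomp n U c (A + B)" and p: "1 \<le> p"
    and "hermitian_psd A" "hermitian_psd B"
  shows "(\<Sum>i<n. c i powr p) powr (1 / p) \<le>
    (\<Sum>i<n. a i powr p) powr (1 / p) + (\<Sum>i<n. b i powr p) powr (1 / p)"
proof -
  have U: "U \<in> carrier_mat n n" "mat_adjoint U * U = 1\<^sub>m n"
    using SC by (auto simp: spectral_decomp_def)
  note A = spectral_decomp_carrier[OF SA] and B = spectral_decomp_carrier[OF SB]
  define x where "x i = Re ((A *\<^sub>v col U i) \<bullet>c col U i)" for i
  define y where "y i = Re ((B *\<^sub>v col U i) \<bullet>c col U i)" for i
  have colU: "col U i \<in> carrier_vec n" for i using U by (auto intro!: carrier_vecI)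
  have "c i = x i + y i" if "i < n" for i
    using spectral_quadratic_form_col[OF SC that] quadratic_form_add[OF A B colU]
    by (simp add: x_def y_def)
  then have "(\<Sum>i<n. c i powr p) powr (1 / p) = (\<Sum>i<n. (x i + y i) powr p) powr (1 / p)" by simp
  also have "\<dots> \<le> (\<Sum>i<n. x i powr p) powr (1 / p) + (\<Sum>i<n. y i powr p) powr (1 / p)"
    using assms(5,6) A B colU by (intro minkowski_sum p) (auto simp: x_def y_def hermitian_psd_def)
  \<comment> \<open>\<open>x\<close> and \<open>y\<close> are diagonals in the eigenbasis of
    \<open>A + B\<close>, in general not eigenvalues of \<open>A\<close> and \<open>B\<close>;
    \<open>sum_powr_diagonal_le\<close> passes to the latter.\<close>
  also have "\<dots> \<le> (\<Sum>i<n. a i powr p) powr (1 / p) + (\<Sum>i<n. b i powr p) powr (1 / p)"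
    using p sum_powr_diagonal_le[OF SA spectral_decomp_psd_nonneg[OF SA assms(5)] U p]
      sum_powr_diagonal_le[OF SB spectral_decomp_psd_nonneg[OF SB assms(6)] U p]
    by (intro add_mono powr_mono2) (auto simp: x_def y_def intro!: sum_nonneg)
  finally show ?thesis .
qed

theorem theorem5p10:
  fixes p :: ereal and n :: nat and A B :: "complex mat"
  assumes "1 \<le> p"
    and "A \<in> carrier_mat n n" and "B \<in> carrier_mat n n"
    and "A \<noteq> 0\<^sub>m n n" and "B \<noteq> 0\<^sub>m n n"
    and "hermitian_psd A" and "hermitian_psd B"
  shows "stable_rank_root p (A + B) \<le> stable_rank_root p A + stable_rank_root p B"
proof -
  note A = assms(2) and B = assms(3)
  \<comment> \<open>In dimension 0 every matrix is the zero matrix.\<close>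
  have n: "0 < n"
    using assms(2,4) by (cases n) (auto intro!: eq_matI)
  have psd: "hermitian_psd (A + B)"
    using assms(6,7) A B
    by (simp add: hermitian_psd_def hermitian_mat_def mat_adjoint_add[OF A B] quadratic_form_add[OF A B])
  obtain V a where SA: "spectral_decomp n V a A"
    using hermitian_spectral_decomp[OF A] assms(6) by (auto simp: hermitian_psd_def hermitian_mat_def)
  obtain W b where SB: "spectral_decomp n W b B"
    using hermitian_spectral_decomp[OF B] assms(7) by (auto simp: hermitian_psd_def hermitian_mat_def)
  obtain U c where SC: "spectral_decomp n U c (A + B)"
    using hermitian_spectral_decomp[of "A + B" n] A B psd by (auto simp: hermitian_psd_def hermitian_mat_def)
  note a = spectral_decomp_psd_nonneg[OF SA assms(6)]
    and b = spectral_decomp_psd_nonneg[OF SB assms(7)]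
    and c = spectral_decomp_psd_nonneg[OF SC psd]
  define ma where "ma = Max (a ` {..<n})"
  define mb where "mb = Max (b ` {..<n})"
  define mc where "mc = Max (c ` {..<n})"
  have "ma > 0" "mb > 0"
    unfolding ma_def mb_def using Max_eigenvalue_pos SA SB assms by blast+
  \<comment> \<open>The forms of \<open>A + B\<close> and \<open>A\<close> differ by the form of
    \<open>B\<close>, which is nonnegative.\<close>
  have "ma \<le> mc"
    unfolding ma_def mc_def using assms(7) B
    by (intro Max_eigenvalue_mono[OF SA SC n]) (simp add: quadratic_form_add[OF A B] hermitian_psd_def)
  have "mb \<le> mc"
    unfolding mb_def mc_def using assms(6) A
    by (intro Max_eigenvalue_mono[OF SB SC n]) (simp add: quadratic_form_add[OF A B] hermitian_psd_def)
  have "mc > 0" using \<open>ma > 0\<close> \<open>ma \<le> mc\<close> by simp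
  let ?root = "\<lambda>d m. if p = \<infinity> then 1
    else (\<Sum>i<n. d i powr real_of_ereal p) powr (1 / real_of_ereal p) / m"
  have root: "stable_rank_root p A = ?root a ma" "stable_rank_root p B = ?root b mb"
    "stable_rank_root p (A + B) = ?root c mc"
    using stable_rank_root_spectral[OF SA a] stable_rank_root_spectral[OF SB b]
      stable_rank_root_spectral[OF SC c] \<open>ma > 0\<close> \<open>mb > 0\<close> \<open>mc > 0\<close> n assms(1)
    unfolding ma_def mb_def mc_def by blast+
  show ?thesis
  proof (cases "p = \<infinity>")
    case True
    \<comment> \<open>All three roots are 1, so the claim is \<open>1 \<le> 1 + 1\<close>.\<close>
    then show ?thesis unfolding root by simp
  next
    case False
    define r where "r = real_of_ereal p"
    have "1 \<le> r" using assms(1) False by (cases p) (auto simp: r_def)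
    let ?s = "\<lambda>d. (\<Sum>i<n. d i powr r) powr (1 / r)"
    have "?s c / mc \<le> (?s a + ?s b) / mc"
      using \<open>mc > 0\<close> schatten_triangle_spectral[OF SA SB SC \<open>1 \<le> r\<close> assms(6,7)]
      by (intro divide_right_mono) auto
    also have "\<dots> = ?s a / mc + ?s b / mc" by (rule add_divide_distrib)
    \<comment> \<open>Each denominator \<open>mc\<close> is replaced by a smaller positive one,
      which increases the quotient of nonnegative numbers.\<close>
    also have "\<dots> \<le> ?s a / ma + ?s b / mb"
      using \<open>ma > 0\<close> \<open>mb > 0\<close> \<open>ma \<le> mc\<close> \<open>mb \<le> mc\<close>
      by (intro add_mono divide_left_mono) auto
    finally show ?thesis using False by (simp add: root r_def)
  qed
qed

end
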